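(* Let $p\in\mathbb{N}$, $b>0$, let $z_0\in\mathbb{C}$ with $|z_0|=1+b$, and let $f_p(z)=(z-z_0)^{-p}$. Let $\operatorname{R}_n[f_p]$ be the quadrature error when computing $\int_0^{2\pi}f_p(e^{it})\,\mathrm{d}t$ using the $n$-point trapezoidal rule. Then, in the limit $n\to\infty$, $$|\operatorname{R}_n[f_p]|\simeq 2\pi\,\frac{(n+p)^{p-1}}{(p-1)!}\,(1+b)^{-(n+p)}.$$
   Context: $\mathbb{N}=\{1,2,3,\dots\}$. The notation $a(n)\simeq b(n)$ means asymptotically equal: $\lim_{n\to\infty} a(n)/b(n)=1$. For a function $f$ on the unit circle, the $n$-point trapezoidal rule approximating $\int_0^{2\pi}f(e^{it})\,\mathrm{d}t$ is $\operatorname{Q}_n[f]=\frac{2\pi}{n}\sum_{k=1}^n f(z_k)$ with $z_k=e^{2\pi i k/n}$, and the quadrature error is $\operatorname{R}_n[f]=\int_0^{2\pi}f(e^{it})\,\mathrm{d}t-\operatorname{Q}_n[f]$. *)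

theory Defs
  imports "HOL-Analysis.Analysis" "HOL-Library.Landau_Symbols"
begin

unbundle asymp_equiv_syntax

definition trapezoidal :: "nat \<Rightarrow> (complex \<Rightarrow> complex) \<Rightarrow> complex" where
  "trapezoidal n f =
     complex_of_real (2 * pi / real n) * (\<Sum>k=1..n. f (cis (2 * pi * real k / real n)))"

definition quad_error :: "nat \<Rightarrow> (complex \<Rightarrow> complex) \<Rightarrow> complex" where
  "quad_error n f = integral {0..2 * pi} (\<lambda>t. f (cis t)) - trapezoidal n f"

end

theory Submission
  imports Defs
begin

text \<open>
  Because $|z_0| > 1$, on the unit circle $f_p(z) = (-z_0)^{-p} (1 - z/z_0)^{-p}$ has the absolutely convergent
  binomial expansion with coefficients
  $(-z_0)^{-p} a_j$, where $a_j = {j+q \choose q} z_0^{-j}$ and $q = p-1$.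

  The trapezoidal rule with $n$ nodes confuses $z^j$ with the constant $1$ whenever $n$ divides
  $j$, and integrates all the other powers correctly. Its error is therefore
  $-2\pi$ times the sum of the Taylor coefficients with index $n, 2n, 3n, \dots$
  (\<open>quad_error_aliasing\<close>).

  The coefficient of index $n$ dominates this sum. The reason is that
  ${i+j+q \choose q} \le {i+q \choose q}{j+q \choose q}$
  (\<open>binomial_submultiplicative\<close>), whence $|a_{i+j}| \le |a_i|\,|a_j|$: relative to $|a_n|$, the
  terms of index $2n, 3n, \dots$ have size at most $|a_n|, |a_{2n}|, \dots$, so together at most
  the tail from $n$ on of a convergent series (\<open>first_alias_dominates\<close>).

  It remains to replace ${n+q \choose q}$, a polynomial in $n$ with leading term $n^q/q!$, by
  $(n+p)^q/q!$.
\<close>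

section \<open>Aliasing: the error in terms of Taylor coefficients\<close>

text \<open>The summands are the powers of the $n$-th root of unity $w = e^{2\pi i j/n}$, which is $1$ exactly
  if $n$ divides $j$; otherwise the geometric sum over a full period vanishes.\<close>

lemma sum_powers_of_root_of_unity:
  assumes "n \<ge> 1"
  shows "(\<Sum>k=1..n. cis (2 * pi * real k / real n) ^ j) = (if n dvd j then of_nat n else 0)"
proof -
  define w where "w = cis (2 * pi * real j / real n)"
  have w: "cis (2 * pi * real k / real n) ^ j = w ^ k" for k
    unfolding w_def Complex.DeMoivre by (rule arg_cong[of _ _ cis]) simp
  have "w = exp (2 * complex_of_real pi * \<i> * of_nat j / of_nat n)"
    by (simp add: w_def cis_conv_exp mult_ac)
  hence w1: "w = 1 \<longleftrightarrow> n dvd j"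
    using complex_root_unity_eq_1[OF assms] by simp
  have wn: "w ^ n = 1"
    using assms cis_multiple_2pi[of "real j"] by (simp add: w_def Complex.DeMoivre mult_ac)
  show ?thesis
  proof (cases "w = 1")
    case True
    then show ?thesis using w1 by (simp add: w)
  next
    case False
    have "(\<Sum>k=1..n. w ^ k) = 0"
      using False assms wn by (simp add: sum_gp)
    then show ?thesis using w1 False by (simp add: w)
  qed
qed

lemma has_integral_cis_power:
  "((\<lambda>t. cis t ^ j) has_integral (if j = 0 then 2 * pi else 0)) {0..2 * pi}"
proof (cases "j = 0")
  case True
  then show ?thesis using has_integral_const_real[of "1::complex" 0 "2 * pi"]
    by (simp add: scaleR_conv_of_real)
next
  case False
  define F where "F t = cis t ^ j / (of_nat j * \<i>)" for t
  have "((\<lambda>t. cis t ^ j) has_integral (F (2 * pi) - F 0)) {0..2 * pi}"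
  proof (rule fundamental_theorem_of_calculus)
    fix t assume "t \<in> {0..2 * pi}"
    have "((\<lambda>z. exp (\<i> * z) ^ j / (of_nat j * \<i>)) has_field_derivative exp (\<i> * of_real t) ^ j)
            (at (of_real t))"
      using False
      by (auto intro!: derivative_eq_intros simp: field_simps simp flip: power_Suc exp_of_nat_mult)
    from has_vector_derivative_real_field[OF this]
    show "(F has_vector_derivative cis t ^ j) (at t within {0..2 * pi})"
      by (simp add: F_def[abs_def] cis_conv_exp)
  qed simp
  moreover have "F (2 * pi) = F 0" by (simp add: F_def)
  ultimately show ?thesis using False by simp
qed

lemma quad_error_monomial:
  assumes "n \<ge> 1"
  shows "quad_error n (\<lambda>z. z ^ j) = (if j > 0 \<and> n dvd j then - 2 * pi else 0)"
proof -
  have "trapezoidal n (\<lambda>z. z ^ j) = (if n dvd j then 2 * pi else 0)"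
    unfolding trapezoidal_def sum_powers_of_root_of_unity[OF assms] using assms by simp
  then show ?thesis
    using integral_unique[OF has_integral_cis_power[of j]] by (simp add: quad_error_def)
qed

text \<open>Absolute summability of the coefficients makes the series converge uniformly on the circle, so it
  may be integrated termwise.\<close>

lemma quad_error_power_series:
  fixes a :: "nat \<Rightarrow> complex"
  assumes summable: "summable (\<lambda>j. norm (a j))"
    and f: "\<And>z. norm z = 1 \<Longrightarrow> (\<lambda>j. a j * z ^ j) sums f z"
  shows "(\<lambda>j. a j * quad_error n (\<lambda>z. z ^ j)) sums quad_error n f"
proof -
  have "uniform_limit {0..2 * pi} (\<lambda>N t. \<Sum>j<N. a j * cis t ^ j)
          (\<lambda>t. \<Sum>j. a j * cis t ^ j) sequentially"
    by (rule Weierstrass_m_test[OF _ summable]) (simp add: norm_mult norm_power)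
  also have "(\<lambda>t. \<Sum>j. a j * cis t ^ j) = (\<lambda>t. f (cis t))"
    using f by (auto simp: sums_iff)
  finally have "uniform_limit {0..2 * pi} (\<lambda>N t. \<Sum>j<N. a j * cis t ^ j)
          (\<lambda>t. f (cis t)) sequentially" .
  then obtain I J where I: "\<And>N. ((\<lambda>t. \<Sum>j<N. a j * cis t ^ j) has_integral I N) {0..2 * pi}"
    and J: "((\<lambda>t. f (cis t)) has_integral J) {0..2 * pi}" and IJ: "I \<longlonglongrightarrow> J"
    by (rule uniform_limit_integral) (auto intro!: continuous_intros)
  have "I = (\<lambda>N. \<Sum>j<N. a j * integral {0..2 * pi} (\<lambda>t. cis t ^ j))"
  proof (rule ext, rule has_integral_unique[OF I])
    fix N
    show "((\<lambda>t. \<Sum>j<N. a j * cis t ^ j) has_integral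
            (\<Sum>j<N. a j * integral {0..2 * pi} (\<lambda>t. cis t ^ j))) {0..2 * pi}"
      using has_integral_cis_power
      by (intro has_integral_sum has_integral_mult_right) (auto simp: has_integral_integral)
  qed
  with IJ J have int: "(\<lambda>j. a j * integral {0..2 * pi} (\<lambda>t. cis t ^ j)) sums
      integral {0..2 * pi} (\<lambda>t. f (cis t))"
    by (simp add: sums_def integral_unique)
  have "(\<lambda>j. complex_of_real (2 * pi / real n) *
           (\<Sum>k=1..n. a j * cis (2 * pi * real k / real n) ^ j)) sums trapezoidal n f"
    unfolding trapezoidal_def by (intro sums_mult sums_sum f) simp
  hence "(\<lambda>j. a j * trapezoidal n (\<lambda>z. z ^ j)) sums trapezoidal n f"
    by (simp add: trapezoidal_def sum_distrib_left mult_ac)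
  from sums_diff[OF int this] show ?thesis
    by (simp add: quad_error_def algebra_simps)
qed

lemma sums_multiples_iff:
  fixes g :: "nat \<Rightarrow> 'a::real_normed_vector"
  assumes "n \<ge> 1"
  shows "(\<lambda>j. if n dvd j then g j else 0) sums s \<longleftrightarrow> (\<lambda>m. g (m * n)) sums s"
proof -
  have "strict_mono (\<lambda>m. m * n)" using assms by (auto intro!: strict_monoI)
  then show ?thesis
    using sums_mono_reindex[of "\<lambda>m. m * n" "\<lambda>j. if n dvd j then g j else 0" s]
    by (auto simp: image_iff dvd_def mult.commute)
qed

lemma summable_multiples:
  fixes g :: "nat \<Rightarrow> 'a::banach"
  assumes "summable (\<lambda>j. norm (g j))" "n \<ge> 1"
  shows "summable (\<lambda>m. g (m * n))"
proof -
  have "summable (\<lambda>j. if n dvd j then g j else 0)"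
    by (rule summable_comparison_test'[OF assms(1)]) auto
  then show ?thesis using sums_multiples_iff[OF assms(2)] by (auto simp: summable_def)
qed

text \<open>The index $0$ is missing from the sum because the rule is exact for constants.\<close>

theorem quad_error_aliasing:
  fixes a :: "nat \<Rightarrow> complex"
  assumes summable: "summable (\<lambda>j. norm (a j))"
    and f: "\<And>z. norm z = 1 \<Longrightarrow> (\<lambda>j. a j * z ^ j) sums f z"
    and n: "n \<ge> 1"
  shows "quad_error n f = - 2 * pi * (\<Sum>m. a (Suc m * n))"
proof -
  have "(\<lambda>j. a j * quad_error n (\<lambda>z. z ^ j)) sums quad_error n f"
    by (rule quad_error_power_series[OF summable f])
  also have "(\<lambda>j. a j * quad_error n (\<lambda>z. z ^ j)) =
      (\<lambda>j. if n dvd j then (if j = 0 then 0 else - 2 * pi * a j) else 0)"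
    using n by (auto simp: quad_error_monomial)
  finally have "(\<lambda>m. if m * n = 0 then 0 else - 2 * pi * a (m * n)) sums quad_error n f"
    by (simp only: sums_multiples_iff[OF n])
  from sums_split_initial_segment[OF this, of 1] n
  have "(\<lambda>m. - 2 * pi * a (Suc m * n)) sums quad_error n f" by simp
  moreover have "summable (\<lambda>m. a (Suc m * n))"
    using summable_multiples[OF summable n] by (subst summable_Suc_iff)
  ultimately show ?thesis
    by (metis sums_unique suminf_mult)
qed

section \<open>The first alias dominates\<close>

lemma suminf_tail_tendsto_0:
  fixes f :: "nat \<Rightarrow> 'a::banach"
  assumes "summable f"
  shows "(\<lambda>n. \<Sum>j. f (j + n)) \<longlonglongrightarrow> 0"
  using tendsto_diff[OF tendsto_const[of "suminf f"] summable_LIMSEQ[OF assms]]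
  by (simp add: suminf_minus_initial_segment[OF assms])

text \<open>Submultiplicativity gives $|a_{(m+2)n}| \le |a_n|\,|a_{(m+1)n}|$, so the
  terms after $a_n$ add up to at most $|a_n| \sum_{j \ge n} |a_j|$, and the last sum tends to $0$.\<close>

lemma first_alias_dominates:
  fixes a :: "nat \<Rightarrow> 'a::banach"
  assumes summable: "summable (\<lambda>j. norm (a j))"
    and submult: "\<And>i j. norm (a (i + j)) \<le> norm (a i) * norm (a j)"
    and nz: "\<And>j. a j \<noteq> 0"
  shows "(\<lambda>n. norm (\<Sum>m. a (Suc m * n))) \<sim>[sequentially] (\<lambda>n. norm (a n))"
proof (rule asymp_equivI')
  define T where "T n = (\<Sum>j. norm (a (j + n)))" for n
  have T: "T \<longlonglongrightarrow> 0"
    unfolding T_def by (rule suminf_tail_tendsto_0[OF summable])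
  have bound: "\<bar>norm (\<Sum>m. a (Suc m * n)) / norm (a n) - 1\<bar> \<le> T n" if n: "n \<ge> 1" for n
  proof -
    have sumn: "summable (\<lambda>m. norm (a (m * n)))"
      using summable_multiples[of "\<lambda>j. norm (a j)"] summable n by simp
    have sum1: "summable (\<lambda>m. norm (a (Suc m * n)))"
      using sumn by (subst summable_Suc_iff)
    have sum2: "summable (\<lambda>m. norm (a (Suc (Suc m) * n)))"
      using sum1 by (subst summable_Suc_iff[where f = "\<lambda>m. norm (a (Suc m * n))"])
    have tail_n: "summable (\<lambda>j. norm (a (j + n)))"
      using summable by (subst summable_iff_shift)
    have "(\<Sum>m. a (Suc m * n)) - a n = (\<Sum>m. a (Suc (Suc m) * n))"
      using suminf_split_head[OF summable_norm_cancel[OF sum1]] by simp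
    hence "\<bar>norm (\<Sum>m. a (Suc m * n)) - norm (a n)\<bar> \<le> norm (\<Sum>m. a (Suc (Suc m) * n))"
      by (metis norm_triangle_ineq3)
    also have "\<dots> \<le> (\<Sum>m. norm (a (Suc (Suc m) * n)))"
      by (rule summable_norm[OF sum2])
    also have "\<dots> \<le> (\<Sum>m. norm (a n) * norm (a (Suc m * n)))"
      using submult[of n] by (intro suminf_le sum2 summable_mult sum1) simp
    also have "\<dots> = norm (a n) * (\<Sum>m. norm (a (Suc m * n)))"
      by (rule suminf_mult[OF sum1])
    \<comment> \<open>the positive multiples of \<open>n\<close> are among the indices from \<open>n\<close> on\<close>
    also have "(\<Sum>m. norm (a (Suc m * n))) \<le> T n"
    proof -
      have "(\<lambda>m. norm (a (Suc m * n))) sums (\<Sum>m. norm (a (Suc m * n)))"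
        using sum1 by (rule summable_sums)
      hence "(\<lambda>j. if n dvd j then norm (a (j + n)) else 0) sums (\<Sum>m. norm (a (Suc m * n)))"
        by (subst sums_multiples_iff[OF n]) (simp add: add.commute)
      then show ?thesis
        unfolding T_def by (rule sums_le[OF _ _ summable_sums[OF tail_n], rotated]) simp
    qed
    finally have "\<bar>norm (\<Sum>m. a (Suc m * n)) - norm (a n)\<bar> \<le> norm (a n) * T n"
      by (simp add: mult_left_mono)
    moreover have "norm (\<Sum>m. a (Suc m * n)) / norm (a n) - 1 =
        (norm (\<Sum>m. a (Suc m * n)) - norm (a n)) / norm (a n)"
      using nz[of n] by (simp add: field_simps)
    ultimately show ?thesis
      using nz[of n] by (simp add: abs_divide divide_le_eq mult.commute)
  qed
  have "(\<lambda>n. norm (\<Sum>m. a (Suc m * n)) / norm (a n) - 1) \<longlonglongrightarrow> 0"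
    by (rule Lim_null_comparison[OF _ T])
       (use bound in \<open>auto intro!: eventually_sequentiallyI[of 1]\<close>)
  then show "(\<lambda>n. norm (\<Sum>m. a (Suc m * n)) / norm (a n)) \<longlonglongrightarrow> 1"
    by (rule LIM_zero_cancel)
qed

section \<open>Binomial coefficients\<close>

lemma Suc_times_binomial_shift:
  "Suc q * ((k + Suc q) choose Suc q) = Suc (k + q) * ((k + q) choose q)"
  using Suc_times_binomial[of q "k + q"] by simp

text \<open>Both sides are products over $1 \le s \le q$, and they compare factor by factor:
  $\frac{i+j+s}{s} \le \frac{i+s}{s} \cdot \frac{j+s}{s}$. The induction adds one factor at
  a time, with denominators cleared.\<close>

lemma binomial_submultiplicative:
  "((i + j + q) choose q) \<le> ((i + q) choose q) * ((j + q) choose q)"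
proof (induction q)
  case 0
  then show ?case by simp
next
  case (Suc q)
  have "Suc q * (Suc q * ((i + j + Suc q) choose Suc q)) =
      Suc q * Suc (i + j + q) * ((i + j + q) choose q)"
    by (simp only: Suc_times_binomial_shift mult.assoc)
  also have "\<dots> \<le> (Suc (i + q) * Suc (j + q)) * (((i + q) choose q) * ((j + q) choose q))"
    by (rule mult_mono[OF _ Suc.IH]) (simp_all add: algebra_simps)
  also have "\<dots> = (Suc (i + q) * ((i + q) choose q)) * (Suc (j + q) * ((j + q) choose q))"
    by (simp only: mult_ac)
  also have "\<dots> = Suc q * (Suc q * (((i + Suc q) choose Suc q) * ((j + Suc q) choose Suc q)))"
    by (simp only: Suc_times_binomial_shift[symmetric] mult_ac)
  finally show ?case by (simp only: mult_le_cancel1)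
qed

lemma shift_asymp_equiv: "(\<lambda>n. real (n + c)) \<sim>[sequentially] real"
proof -
  have "(\<lambda>_. real c) \<in> o[sequentially](real)"
    by (intro smalloI_tendsto)
       (auto intro!: tendsto_divide_0[OF tendsto_const] filterlim_real_sequentially
          filterlim_at_top_imp_at_infinity eventually_gt_at_top[THEN eventually_mono])
  then show ?thesis by (simp add: asymp_equiv_add_right)
qed

lemma binomial_asymp_equiv:
  "(\<lambda>n. real ((n + q) choose q)) \<sim>[sequentially] (\<lambda>n. real n ^ q / fact q)"
proof (induction q)
  case 0
  then show ?case by simp
next
  case (Suc q)
  have "real ((n + Suc q) choose Suc q) =
      real (n + Suc q) * real ((n + q) choose q) / real (Suc q)" for n
    using Suc_times_binomial_shift[of q n, THEN arg_cong[where f = real]]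
    by (simp only: of_nat_mult) (simp add: field_simps)
  moreover have "(\<lambda>n. real (n + Suc q) * real ((n + q) choose q) / real (Suc q))
      \<sim>[sequentially] (\<lambda>n. real n * (real n ^ q / fact q) / real (Suc q))"
    by (intro asymp_equiv_intros shift_asymp_equiv Suc.IH)
  ultimately show ?case by (simp add: mult_ac)
qed

section \<open>The error for a pole of order $p$\<close>

lemma negative_binomial_series:
  fixes w :: complex
  assumes "norm w < 1"
  shows "summable (\<lambda>j. norm (of_nat ((j + q) choose q) * w ^ j))"
    and "(\<lambda>j. of_nat ((j + q) choose q) * w ^ j) sums inverse ((1 - w) ^ Suc q)"
proof -
  have coeff: "(- of_nat (Suc q) gchoose j) * (- w) ^ j = of_nat ((j + q) choose q) * w ^ j" for j
  proof -
    have "(- of_nat (Suc q) gchoose j :: complex) = (- 1) ^ j * of_nat ((j + q) choose q)"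
      using binomial_symmetric[of q "j + q"]
      by (subst gbinomial_minus) (simp add: binomial_gbinomial add_ac)
    then show ?thesis by (simp add: power_minus[of w] mult_ac flip: power_add)
  qed
  have "summable (\<lambda>j. norm ((- of_nat (Suc q) gchoose j) * (- w) ^ j))"
    using assms by (intro abs_summable_in_conv_radius) (simp add: conv_radius_gchoose)
  then show "summable (\<lambda>j. norm (of_nat ((j + q) choose q) * w ^ j))"
    by (simp only: coeff)
  have "(1 - w) \<noteq> 0" using assms by auto
  hence "(1 + - w) powr (- of_nat (Suc q)) = inverse ((1 - w) ^ Suc q)"
    using powr_nat'[of "1 - w" "Suc q"] by (simp only: powr_minus) simp
  with gen_binomial_complex[of "- w" "- of_nat (Suc q)"] assms
  show "(\<lambda>j. of_nat ((j + q) choose q) * w ^ j) sums inverse ((1 - w) ^ Suc q)"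
    by (simp only: coeff norm_minus_cancel)
qed

theorem theorem3:
  fixes p :: nat and b :: real and z0 :: complex
  assumes "p \<ge> 1"
    and "b > 0"
    and "norm z0 = 1 + b"
  shows "(\<lambda>n. norm (quad_error n (\<lambda>z. (z - z0) powi (- int p))))
         \<sim>[sequentially]
         (\<lambda>n. 2 * pi * (real (n + p) ^ (p - 1) / fact (p - 1)) * (1 + b) powi (- int (n + p)))"
proof -
  define q where "q = p - 1"
  have p: "p = Suc q" using assms(1) by (simp add: q_def)
  have z0: "z0 \<noteq> 0" using assms by auto
  define a where "a j = of_nat ((j + q) choose q) * inverse z0 ^ j" for j
  \<comment> \<open>the constant in $(z - z_0)^{-p} = (-z_0)^{-p} (1 - z/z_0)^{-p}$ stays outside \<open>a\<close>:
    with it the coefficients need not be submultiplicative\<close>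
  define A where "A = inverse ((- z0) ^ p)"
  have inv: "norm (inverse z0) < 1"
    using assms by (simp add: norm_inverse inverse_less_1_iff)
  have summable_a: "summable (\<lambda>j. norm (a j))"
    unfolding a_def by (rule negative_binomial_series(1)[OF inv])
  have series: "(\<lambda>j. A * a j * z ^ j) sums ((z - z0) powi (- int p))" if "norm z = 1" for z
  proof -
    have "norm (inverse z0 * z) < 1" using inv that by (simp add: norm_mult)
    from sums_mult[OF negative_binomial_series(2)[OF this, of q], of A]
    have "(\<lambda>j. A * a j * z ^ j) sums (A * inverse ((1 - inverse z0 * z) ^ p))"
      by (simp add: a_def p power_mult_distrib mult_ac)
    also have "A * inverse ((1 - inverse z0 * z) ^ p) = inverse ((- z0 * (1 - inverse z0 * z)) ^ p)"
      by (simp only: A_def power_mult_distrib inverse_mult_distrib)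
    also have "- z0 * (1 - inverse z0 * z) = z - z0" using z0 by (simp add: field_simps)
    finally show ?thesis by (simp add: power_int_minus)
  qed
  have error: "norm (quad_error n (\<lambda>z. (z - z0) powi (- int p))) =
      2 * pi * inverse ((1 + b) ^ p) * norm (\<Sum>m. a (Suc m * n))" if "n \<ge> 1" for n
  proof -
    have "summable (\<lambda>j. norm (A * a j))"
      using summable_a by (simp add: norm_mult summable_mult)
    from quad_error_aliasing[OF this series that]
    have "quad_error n (\<lambda>z. (z - z0) powi (- int p)) = - 2 * pi * (\<Sum>m. A * a (Suc m * n))" .
    also have "(\<Sum>m. A * a (Suc m * n)) = A * (\<Sum>m. a (Suc m * n))"
      using summable_multiples[OF summable_a that]
      by (intro suminf_mult) (subst summable_Suc_iff)
    finally show ?thesis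
      using assms by (simp add: norm_mult A_def norm_inverse norm_power)
  qed
  have submult: "norm (a (i + j)) \<le> norm (a i) * norm (a j)" for i j
  proof -
    have "real ((i + j + q) choose q) \<le> real ((i + q) choose q) * real ((j + q) choose q)"
      using binomial_submultiplicative[of i j q] by (simp flip: of_nat_mult)
    then have "real ((i + j + q) choose q) * norm (inverse z0) ^ (i + j) \<le>
        real ((i + q) choose q) * real ((j + q) choose q) * norm (inverse z0) ^ (i + j)"
      by (rule mult_right_mono) simp
    then show ?thesis
      by (simp add: a_def norm_mult norm_power power_add mult_ac)
  qed
  have "(\<lambda>n. norm (quad_error n (\<lambda>z. (z - z0) powi (- int p)))) \<sim>[sequentially]
      (\<lambda>n. 2 * pi * inverse ((1 + b) ^ p) * norm (\<Sum>m. a (Suc m * n)))"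
    by (intro asymp_equiv_refl_ev eventually_sequentiallyI[of 1] error)
  also have "\<dots> \<sim>[sequentially] (\<lambda>n. 2 * pi * inverse ((1 + b) ^ p) * norm (a n))"
    using z0 by (intro asymp_equiv_intros first_alias_dominates summable_a submult) (simp add: a_def)
  also have "(\<lambda>n. 2 * pi * inverse ((1 + b) ^ p) * norm (a n)) =
      (\<lambda>n. 2 * pi * inverse ((1 + b) ^ p) * (real ((n + q) choose q) * inverse ((1 + b) ^ n)))"
    using assms by (simp add: a_def norm_mult norm_power norm_inverse power_inverse)
  also have "\<dots> \<sim>[sequentially] (\<lambda>n. 2 * pi * inverse ((1 + b) ^ p) *
      (real (n + p) ^ q / fact q * inverse ((1 + b) ^ n)))"
  proof -
    have "(\<lambda>n. real n ^ q / fact q) \<sim>[sequentially] (\<lambda>n. real (n + p) ^ q / fact q)"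
      by (intro asymp_equiv_intros asymp_equiv_symI[OF shift_asymp_equiv])
    from asymp_equiv_trans[OF binomial_asymp_equiv this] show ?thesis
      by (intro asymp_equiv_intros)
  qed
  also have "\<dots> = (\<lambda>n. 2 * pi * (real (n + p) ^ (p - 1) / fact (p - 1)) *
      (1 + b) powi (- int (n + p)))"
    by (simp add: q_def power_int_minus power_add mult_ac flip: of_nat_add)
  finally show ?thesis .
qed

end
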